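(* For every gauge $\phi$ and every $s\in\mathbb S$: (i) $\mathcal D_{\ell^2}(\overline s)\neq\mathcal N(\mathscr H^\phi_{\ell^2})$; (ii) $\mathcal D_{\ell^2}(\overline s)\neq\mathcal N_\sigma(\mathscr H^\phi_{\ell^2})$.
   Context: $\mathbb S$ is the set of all strictly decreasing sequences $s=(s_n)_{n\geq1}$ of positive reals converging to $0$. For $s\in\mathbb S$ and $k\geq1$ let $s^{\times k}=(s_{kn})_{n\geq1}$, and let $\overline s=\{s^{\times k}:k\geq1\}$. For $S\subseteq\mathbb S$ and a separable metric space $X$, a set $E\subseteq X$ is $S$-dominated if for each $t\in S$ there is a sequence $(E_n)_{n\geq1}$ of subsets of $X$ that covers $E$ and satisfies $\operatorname{diam}E_n<t_n$ for all $n$; $\mathcal D_X(S)$ is the family of all $S$-dominated subsets of $X$. A gauge is a non-decreasing right-continuous function $\phi\colon[0,\infty)\to[0,\infty)$ with $\phi(0)=0$ and $\phi(r)>0$ for $r>0$. The Hausdorff measure is $\mathscr H^\phi_X(E)=\sup_{\delta>0}\inf\{\sum_n\phi(\operatorname{diam}E_n):\{E_n\}\text{ a countable cover of }E\text{ by subsets of }X\text{ with }\operatorname{diam}E_n<\delta\text{ for all }n\}$. $\mathcal N(\mathscr H^\phi_X)$ is the family of sets $E\subseteq X$ with $\mathscr H^\phi_X(E)=0$, and $\mathcal N_\sigma(\mathscr H^\phi_X)$ is the family of subsets of $X$ of $\sigma$-finite $\mathscr H^\phi_X$ measure. $\ell^2$ is the Hilbert space of square-summable real sequences with its norm metric. 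*)

theory Defs
  imports "HOL-Analysis.Analysis"
begin

section \<open>The Hilbert space of square-summable real sequences\<close>

typedef ell2 = "{x :: nat \<Rightarrow> real. summable (\<lambda>i. (x i)\<^sup>2)}"
  morphisms ell2_nth Abs_ell2
  by (rule exI[of _ "\<lambda>_. 0"]) simp

lemma summable_ell2_nth: "summable (\<lambda>i. (ell2_nth x i)\<^sup>2)"
  using ell2_nth[of x] by simp

lemma ell2_eqI: "(\<And>i. ell2_nth x i = ell2_nth y i) \<Longrightarrow> x = y"
  using ell2_nth_inject by blast

lemma summable_ell2_mult: "summable (\<lambda>i. ell2_nth x i * ell2_nth y i)"
proof (rule summable_comparison_test)
  show "summable (\<lambda>i. (ell2_nth x i)\<^sup>2 + (ell2_nth y i)\<^sup>2)"
    by (intro summable_add summable_ell2_nth)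
  have "\<bar>a * b\<bar> \<le> a\<^sup>2 + b\<^sup>2" for a b :: real
    using sum_squares_bound[of "\<bar>a\<bar>" "\<bar>b\<bar>"] abs_ge_zero[of "a * b"]
    unfolding abs_mult power2_abs by linarith
  then show "\<exists>N. \<forall>n\<ge>N. norm (ell2_nth x n * ell2_nth y n)
      \<le> (ell2_nth x n)\<^sup>2 + (ell2_nth y n)\<^sup>2"
    by simp
qed

lemma summable_ell2_add: "summable (\<lambda>i. (ell2_nth x i + ell2_nth y i)\<^sup>2)"
proof -
  have "summable (\<lambda>i. (ell2_nth x i)\<^sup>2 + (ell2_nth y i)\<^sup>2 + 2 * (ell2_nth x i * ell2_nth y i))"
    by (intro summable_add summable_mult summable_ell2_nth summable_ell2_mult)
  then show ?thesis
    by (simp add: power2_sum mult.assoc)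
qed

lemma summable_ell2_scale: "summable (\<lambda>i. (c * ell2_nth x i)\<^sup>2)"
  by (simp add: power_mult_distrib summable_mult summable_ell2_nth)

instantiation ell2 :: real_inner
begin

definition zero_ell2 :: ell2 where
  "0 = Abs_ell2 (\<lambda>_. 0)"

definition plus_ell2 :: "ell2 \<Rightarrow> ell2 \<Rightarrow> ell2" where
  "x + y = Abs_ell2 (\<lambda>i. ell2_nth x i + ell2_nth y i)"

definition scaleR_ell2 :: "real \<Rightarrow> ell2 \<Rightarrow> ell2" where
  "c *\<^sub>R x = Abs_ell2 (\<lambda>i. c * ell2_nth x i)"

definition uminus_ell2 :: "ell2 \<Rightarrow> ell2" where
  "- x = (-1) *\<^sub>R (x :: ell2)"

definition minus_ell2 :: "ell2 \<Rightarrow> ell2 \<Rightarrow> ell2" where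
  "x - y = x + - (y :: ell2)"

definition inner_ell2 :: "ell2 \<Rightarrow> ell2 \<Rightarrow> real" where
  "inner x y = (\<Sum>i. ell2_nth x i * ell2_nth y i)"

definition norm_ell2 :: "ell2 \<Rightarrow> real" where
  "norm x = sqrt (inner x (x :: ell2))"

definition sgn_ell2 :: "ell2 \<Rightarrow> ell2" where
  "sgn x = inverse (norm x) *\<^sub>R (x :: ell2)"

definition dist_ell2 :: "ell2 \<Rightarrow> ell2 \<Rightarrow> real" where
  "dist x y = norm (x - y :: ell2)"

definition uniformity_ell2 :: "(ell2 \<times> ell2) filter" where
  "uniformity_ell2 = (INF e\<in>{0 <..}. principal {(x, y). dist x (y :: ell2) < e})"

definition open_ell2 :: "ell2 set \<Rightarrow> bool" where
  "open_ell2 U \<longleftrightarrow> (\<forall>x\<in>U. eventually (\<lambda>(x', y). x' = x \<longrightarrow> y \<in> U) uniformity)"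

lemma ell2_nth_zero [simp]: "ell2_nth 0 i = 0"
  by (simp add: zero_ell2_def Abs_ell2_inverse)

lemma ell2_nth_add [simp]: "ell2_nth (x + y) i = ell2_nth x i + ell2_nth y i"
  by (simp add: plus_ell2_def Abs_ell2_inverse summable_ell2_add)

lemma ell2_nth_scaleR [simp]: "ell2_nth (c *\<^sub>R x) i = c * ell2_nth x i"
  by (simp add: scaleR_ell2_def Abs_ell2_inverse summable_ell2_scale)

lemma ell2_nth_uminus [simp]: "ell2_nth (- x) i = - ell2_nth x i"
  by (simp add: uminus_ell2_def)

lemma ell2_nth_diff [simp]: "ell2_nth (x - y) i = ell2_nth x i - ell2_nth y i"
  by (simp add: minus_ell2_def)

instance
proof
  fix x y z :: ell2 and a b :: real
  show "inner x y = inner y x"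
    by (simp add: inner_ell2_def mult.commute)
  show "inner (x + y) z = inner x z + inner y z"
    by (simp add: inner_ell2_def distrib_right suminf_add summable_ell2_mult)
  show "inner (a *\<^sub>R x) y = a * inner x y"
    by (simp add: inner_ell2_def mult.assoc suminf_mult summable_ell2_mult)
  show "0 \<le> inner x x"
    by (simp add: inner_ell2_def suminf_nonneg summable_ell2_mult)
  have "(inner x x = 0) = (\<forall>i. ell2_nth x i * ell2_nth x i = 0)"
    unfolding inner_ell2_def by (rule suminf_eq_zero_iff) (simp_all add: summable_ell2_mult)
  also have "\<dots> = (x = 0)"
    by (auto intro: ell2_eqI)
  finally show "(inner x x = 0) = (x = 0)" .
qed (auto intro!: ell2_eqI
    simp: algebra_simps norm_ell2_def dist_ell2_def sgn_ell2_def uniformity_ell2_def open_ell2_def)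

end

section \<open>Sequences and domination\<close>

text \<open>A sequence indexed by the positive integers is a function on \<^typ>\<open>nat\<close>
  whose value at 0 is unconstrained and never used.\<close>

definition decr_null_seqs :: "(nat \<Rightarrow> real) set" where
  "decr_null_seqs =
    {s. (\<forall>n\<ge>1. 0 < s n) \<and> (\<forall>m\<ge>1. \<forall>n>m. s n < s m) \<and> s \<longlonglongrightarrow> 0}"

definition mult_subseqs :: "(nat \<Rightarrow> real) \<Rightarrow> (nat \<Rightarrow> real) set" where
  "mult_subseqs s = {(\<lambda>n. s (k * n)) | k. k \<ge> 1}"

text \<open>\<^const>\<open>diameter\<close> is real-valued and meaningful only on bounded sets, so the
  inequality ``diameter less than \<open>r\<close>'' is always paired with \<^const>\<open>bounded\<close>;
  unbounded sets have infinite diameter. The empty set has diameter 0.\<close>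

definition dominated_by :: "(nat \<Rightarrow> real) set \<Rightarrow> 'a::metric_space set \<Rightarrow> bool" where
  "dominated_by S E \<longleftrightarrow>
    (\<forall>t\<in>S. \<exists>C :: nat \<Rightarrow> 'a set.
      E \<subseteq> (\<Union>n\<in>{1..}. C n) \<and> (\<forall>n\<ge>1. bounded (C n) \<and> diameter (C n) < t n))"

definition dominated_sets :: "(nat \<Rightarrow> real) set \<Rightarrow> 'a::metric_space set set" where
  "dominated_sets S = {E. dominated_by S E}"

section \<open>Hausdorff measures\<close>

text \<open>A gauge is a function on the half-line from 0; its values at negative arguments
  are unconstrained and never used.\<close>

definition hausdorff_gauge :: "(real \<Rightarrow> real) \<Rightarrow> bool" where
  "hausdorff_gauge \<phi> \<longleftrightarrow>
    mono_on {0..} \<phi> \<and> (\<forall>r\<ge>0. continuous (at_right r) \<phi>) \<and> \<phi> 0 = 0 \<and> (\<forall>r>0. \<phi> r > 0)"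

text \<open>Finite covers are included: they are padded with empty sets, which contribute
  \<open>\<phi> 0 = 0\<close>.\<close>

definition hausdorff_measure :: "(real \<Rightarrow> real) \<Rightarrow> 'a::metric_space set \<Rightarrow> ennreal" where
  "hausdorff_measure \<phi> E =
    (SUP \<delta>\<in>{0<..}.
      INF C\<in>{C :: nat \<Rightarrow> 'a set.
                E \<subseteq> (\<Union>n. C n) \<and> (\<forall>n. bounded (C n) \<and> diameter (C n) < \<delta>)}.
        \<Sum>n. ennreal (\<phi> (diameter (C n))))"

definition hausdorff_null :: "(real \<Rightarrow> real) \<Rightarrow> 'a::metric_space set set" where
  "hausdorff_null \<phi> = {E. hausdorff_measure \<phi> E = 0}"

definition hausdorff_sigma_finite :: "(real \<Rightarrow> real) \<Rightarrow> 'a::metric_space set set" where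
  "hausdorff_sigma_finite \<phi> =
    {E. \<exists>F :: nat \<Rightarrow> 'a set. E = (\<Union>n. F n) \<and> (\<forall>n. hausdorff_measure \<phi> (F n) < \<infinity>)}"

end

theory Submission
  imports Defs "HOL-Library.Sublist"
begin

text \<open>Both parts follow from a dichotomy on \<open>\<Sum>n. \<phi> (s n)\<close>. Null sets have \<open>\<sigma>\<close>-finite
  measure, so it is enough to find either a null set that is not dominated, or a dominated set
  that is not of \<open>\<sigma>\<close>-finite measure.

  All the sets are built in the same way. Attach to each node \<open>\<tau>\<close> of a finitely branching tree a
  radius \<open>r \<tau> > 0\<close> that decreases to 0 along every branch. The space of branches, with the distance of
  two branches equal to the radius of the node where they split, is a separable ultrametric
  space, and such spaces embed isometrically into \<open>\<ell>\<^sup>2\<close>: send a branch to a sum of multiples of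
  orthogonal vectors, one for each of its edges, where the squared coefficients telescope
  (\<open>dist_point\<close>). So the diameters of pieces of the set can be prescribed freely.

  Lower bounds come from a mass distribution principle (\<open>mass_distribution\<close>). Give the nodes weights,
  where the weight of a node is at most the total weight of its children. If a set \<open>C\<close> contains
  two points of the tree, all its points in the tree lie in the cylinder of some node \<open>\<tau>\<close> with
  \<open>r \<tau> \<le> diameter C\<close>, and
  cylinders whose weights sum to less than the weight of the root leave out a branch
  (\<open>branch_avoiding_nodes\<close>, a greedy descent).

  If the sum converges, then \<open>2 ^ q * \<phi> (s (2 ^ q)) \<longlonglongrightarrow> 0\<close> by Cauchy condensation. Take a sparse
  sequence \<open>q j\<close> and a homogeneous tree with radius \<open>s (2 ^ q j)\<close> and \<open>2 ^ (q j + 3 * j)\<close> nodes at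
  level \<open>j\<close>. These are few enough nodes for the set to be null, but the sets of diameter less than
  \<open>s n\<close>, of which fewer than \<open>2 ^ q j\<close> can contain two branches that split at level \<open>j\<close>, carry at most half
  of the mass.

  If the sum diverges, so does, for every \<open>k\<close>, the sum over the multiples of \<open>k\<close>, which allows an inhomogeneous
  tree. The nodes of level \<open>k\<close> get distinct numbers \<open>n\<close> and radii \<open>s (k * (n + 1)) < s (k * n)\<close>, so
  that they witness domination by \<open>\<lambda>n. s (k * n)\<close>. Divergence makes it possible to give each node
  \<open>\<tau>\<close> finitely many children whose \<open>\<phi>\<close>-values sum to at least \<open>2 * \<phi> (r \<tau>)\<close>. The factor 2 leaves
  room for the weights \<open>(1/2) ^ length \<tau> * \<phi> (r \<tau>)\<close>, which are \<open>o(\<phi> (r \<tau>))\<close>; hence every subset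
  of finite measure has mass 0, and countably many of them do not cover.\<close>

section \<open>Infinite branches of a tree\<close>

text \<open>Nodes are finite histories with the most recent choice first. In this order a node is longer
  than its parent by one \<open>Cons\<close>, so that \<^const>\<open>list_encode\<close> is increasing along branches.\<close>

primrec history :: "(nat \<Rightarrow> nat) \<Rightarrow> nat \<Rightarrow> nat list" where
  "history x 0 = []"
| "history x (Suc j) = x j # history x j"

definition branches :: "(nat list \<Rightarrow> nat set) \<Rightarrow> (nat \<Rightarrow> nat) set" where
  "branches Ch = {x. \<forall>j. x j \<in> Ch (history x j)}"

primrec node :: "(nat list \<Rightarrow> nat set) \<Rightarrow> nat list \<Rightarrow> bool" where
  "node Ch [] \<longleftrightarrow> True"
| "node Ch (i # \<tau>) \<longleftrightarrow> i \<in> Ch \<tau> \<and> node Ch \<tau>"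

definition level :: "(nat list \<Rightarrow> nat set) \<Rightarrow> nat \<Rightarrow> nat list set" where
  "level Ch j = {\<tau>. node Ch \<tau> \<and> length \<tau> = j}"

lemma length_history [simp]: "length (history x j) = j"
  by (induction j) auto

lemma history_eq_iff: "history x j = history y j \<longleftrightarrow> (\<forall>i<j. x i = y i)"
  by (induction j) (auto simp: less_Suc_eq)

lemma node_history: "x \<in> branches Ch \<Longrightarrow> node Ch (history x j)"
  by (induction j) (auto simp: branches_def)

lemma level_0: "level Ch 0 = {[]}"
  by (auto simp: level_def)

lemma level_Suc: "level Ch (Suc j) = (\<lambda>(\<tau>, i). i # \<tau>) ` (SIGMA \<tau>:level Ch j. Ch \<tau>)"
  by (auto simp: level_def image_iff length_Suc_conv)

lemma finite_level:
  assumes "\<And>\<tau>. finite (Ch \<tau>)"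
  shows "finite (level Ch j)"
  by (induction j) (auto simp: level_0 level_Suc assms)

text \<open>A branch is found by keeping the invariant that the budget \<open>b\<close> spent on forbidden nodes at or
  below the current node \<open>\<tau>\<close> is less than \<open>w \<tau>\<close>. Some child inherits it, since the subtrees of the
  children are disjoint and the children carry at least the weight of \<open>\<tau>\<close>. A forbidden node violates
  the invariant, as its own share of the budget already covers its weight.\<close>

lemma branch_avoiding_nodes:
  fixes w :: "nat list \<Rightarrow> real" and b :: "nat \<Rightarrow> ennreal"
  assumes fin: "\<And>\<tau>. finite (Ch \<tau>)"
    and nonneg: "\<And>\<tau>. 0 \<le> w \<tau>"
    and split: "\<And>\<tau>. w \<tau> \<le> (\<Sum>i\<in>Ch \<tau>. w (i # \<tau>))"
    and b: "\<And>n. n \<in> I \<Longrightarrow> ennreal (w (\<sigma> n)) \<le> b n"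
    and less: "(\<Sum>n. b n) < ennreal (w [])"
  obtains x where "x \<in> branches Ch" "\<And>n j. n \<in> I \<Longrightarrow> history x j \<noteq> \<sigma> n"
proof -
  define below where "below \<tau> n = (if n \<in> I \<and> suffix \<tau> (\<sigma> n) then b n else 0)" for \<tau> n
  define light where "light \<tau> \<longleftrightarrow> (\<Sum>n. below \<tau> n) < ennreal (w \<tau>)" for \<tau>
  have "(\<Sum>n. below [] n) \<le> (\<Sum>n. b n)"
    by (intro suminf_le) (auto simp: below_def)
  with less have light_root: "light []"
    by (simp add: light_def)
  have light_child: "\<exists>i\<in>Ch \<tau>. light (i # \<tau>)" if "light \<tau>" for \<tau>
  proof (rule ccontr)
    assume "\<not> (\<exists>i\<in>Ch \<tau>. light (i # \<tau>))"
    then have heavy: "ennreal (w (i # \<tau>)) \<le> (\<Sum>n. below (i # \<tau>) n)" if "i \<in> Ch \<tau>" for i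
      using that by (auto simp: light_def not_less)
    have disjoint: "(\<Sum>i\<in>Ch \<tau>. below (i # \<tau>) n) \<le> below \<tau> n" for n
    proof (cases "\<exists>i\<in>Ch \<tau>. below (i # \<tau>) n \<noteq> 0")
      case True
      then obtain i where i: "i \<in> Ch \<tau>" "n \<in> I" "suffix (i # \<tau>) (\<sigma> n)"
        by (auto simp: below_def split: if_splits)
      have "below (k # \<tau>) n = 0" if "k \<noteq> i" for k
      proof -
        have "\<not> suffix (k # \<tau>) (\<sigma> n)"
          using i(3) that by (auto simp: suffix_def)
        then show ?thesis
          by (simp add: below_def)
      qed
      then have "(\<Sum>k\<in>Ch \<tau>. below (k # \<tau>) n) = below (i # \<tau>) n"
        using fin[of \<tau>] i(1) by (subst sum.remove[of _ i]) (auto intro!: sum.neutral)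
      also have "\<dots> = below \<tau> n"
        using i by (auto simp: below_def dest: suffix_ConsD)
      finally show ?thesis by simp
    qed auto
    have "ennreal (w \<tau>) \<le> ennreal (\<Sum>i\<in>Ch \<tau>. w (i # \<tau>))"
      using split by (rule ennreal_leI)
    also have "\<dots> = (\<Sum>i\<in>Ch \<tau>. ennreal (w (i # \<tau>)))"
      using nonneg by (simp add: sum_ennreal)
    also have "\<dots> \<le> (\<Sum>i\<in>Ch \<tau>. \<Sum>n. below (i # \<tau>) n)"
      using heavy by (rule sum_mono)
    also have "\<dots> = (\<Sum>n. \<Sum>i\<in>Ch \<tau>. below (i # \<tau>) n)"
      by (rule suminf_sum[symmetric]) auto
    also have "\<dots> \<le> (\<Sum>n. below \<tau> n)"
      using disjoint by (intro suminf_le) auto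
    finally show False
      using that by (simp add: light_def)
  qed
  have light_avoids: "\<tau> \<noteq> \<sigma> n" if "light \<tau>" "n \<in> I" for \<tau> n
  proof
    assume eq: "\<tau> = \<sigma> n"
    have "ennreal (w \<tau>) \<le> below \<tau> n"
      using b[OF that(2)] that(2) by (simp add: below_def eq)
    also have "\<dots> \<le> (\<Sum>n. below \<tau> n)"
      using sum_le_suminf[of "below \<tau>" "{n}"] by simp
    finally show False
      using that(1) by (simp add: light_def)
  qed
  define pick where "pick \<tau> = (SOME i. i \<in> Ch \<tau> \<and> light (i # \<tau>))" for \<tau>
  have pick: "pick \<tau> \<in> Ch \<tau> \<and> light (pick \<tau> # \<tau>)" if "light \<tau>" for \<tau>
    unfolding pick_def by (rule someI_ex) (use light_child[OF that] in blast)
  define h where "h = rec_nat [] (\<lambda>_ \<tau>. pick \<tau> # \<tau>)"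
  define x where "x j = pick (h j)" for j
  have history_x: "history x j = h j" for j
    by (induction j) (auto simp: h_def x_def)
  have light_h: "light (h j)" for j
  proof (induction j)
    case 0
    show ?case using light_root by (simp add: h_def)
  next
    case (Suc j)
    then show ?case using pick[of "h j"] by (simp add: h_def)
  qed
  show thesis
  proof (rule that[of x])
    show "x \<in> branches Ch"
      using pick light_h by (auto simp: branches_def history_x x_def)
    show "history x j \<noteq> \<sigma> n" if "n \<in> I" for n j
      using light_avoids[OF light_h that] by (simp add: history_x)
  qed
qed

section \<open>Isometric copies of ultrametric trees in Hilbert space\<close>

text \<open>Since \<open>r\<close> vanishes along every branch, all the squared edge coefficients of a branch telescope to
  the same total, \<open>(r [])\<^sup>2 / 2\<close>. This is what makes the embedding below isometric.\<close>

locale ultrametric_tree =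
  fixes Ch :: "nat list \<Rightarrow> nat set" and r :: "nat list \<Rightarrow> real"
  assumes finite_Ch: "finite (Ch \<tau>)"
    and r_pos: "0 < r \<tau>"
    and r_mono: "i \<in> Ch \<tau> \<Longrightarrow> r (i # \<tau>) \<le> r \<tau>"
    and r_vanish: "x \<in> branches Ch \<Longrightarrow> (\<lambda>j. r (history x j)) \<longlonglongrightarrow> 0"
begin

text \<open>The vector of a branch \<open>x\<close> has the coefficient \<open>edge \<tau>\<close> in the basis direction of \<open>\<tau>\<close>, for each
  nonempty history \<open>\<tau>\<close> of \<open>x\<close>. The squared coefficients below a node \<open>\<tau>\<close> sum to \<open>(r \<tau>)\<^sup>2 / 2\<close>; two branches
  that split at \<open>\<tau>\<close> use different directions from there on, so their squared distance is
  \<open>2 * (r \<tau>)\<^sup>2 / 2\<close>.\<close>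

definition edge :: "nat list \<Rightarrow> real" where
  "edge \<tau> = sqrt (((r (tl \<tau>))\<^sup>2 - (r \<tau>)\<^sup>2) / 2)"

definition coord :: "(nat \<Rightarrow> nat) \<Rightarrow> nat \<Rightarrow> real" where
  "coord x m = (let \<tau> = list_decode m in
     if \<tau> \<noteq> [] \<and> history x (length \<tau>) = \<tau> then edge \<tau> else 0)"

definition point :: "(nat \<Rightarrow> nat) \<Rightarrow> ell2" where
  "point x = Abs_ell2 (coord x)"

definition limit_set :: "ell2 set" where
  "limit_set = point ` branches Ch"

definition cylinder :: "nat list \<Rightarrow> ell2 set" where
  "cylinder \<tau> = point ` {x \<in> branches Ch. history x (length \<tau>) = \<tau>}"

text \<open>Makes it possible to sum the coordinates of a vector along its branch, in increasing order of
  their indices.\<close>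

lemma strict_mono_code: "strict_mono (\<lambda>i. list_encode (history x (Suc i)))"
proof (rule strict_mono_Suc_iff[THEN iffD2], rule allI)
  fix n
  show "list_encode (history x (Suc n)) < list_encode (history x (Suc (Suc n)))"
    using le_prod_encode_2[of "list_encode (history x (Suc n))" "x (Suc n)"]
    by (simp only: history.simps(2)[of x "Suc n"] list_encode.simps(2)[of "x (Suc n)"])
qed

lemma coord_code:
  "coord y (list_encode (history x (Suc i))) =
     (if history x (Suc i) = history y (Suc i) then edge (history x (Suc i)) else 0)"
  by (auto simp: coord_def Let_def simp del: history.simps list_encode.simps)
     (metis length_history list.size(3) nat.simps(3))

lemma coord_off_code:
  assumes "m \<notin> range (\<lambda>i. list_encode (history x (Suc i)))"
  shows "coord x m = 0"
proof (rule ccontr)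
  assume "coord x m \<noteq> 0"
  then have *: "list_decode m \<noteq> []" "history x (length (list_decode m)) = list_decode m"
    by (auto simp: coord_def Let_def split: if_splits)
  then obtain i where "length (list_decode m) = Suc i"
    by (cases "list_decode m") auto
  with *(2) have "list_encode (history x (Suc i)) = m"
    by (metis list_decode_inverse)
  with assms show False by blast
qed

lemma edge_history_sq:
  assumes "x \<in> branches Ch"
  shows "(edge (history x (Suc i)))\<^sup>2 = (r (history x i))\<^sup>2 / 2 - (r (history x (Suc i)))\<^sup>2 / 2"
proof -
  have "r (history x (Suc i)) \<le> r (history x i)"
    using assms by (auto simp: branches_def intro: r_mono)
  then have "(r (history x (Suc i)))\<^sup>2 \<le> (r (history x i))\<^sup>2"
    using r_pos[of "history x (Suc i)"] by (intro power_mono) auto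
  then show ?thesis
    by (simp add: edge_def diff_divide_distrib)
qed

lemma coord_sums:
  assumes "x \<in> branches Ch"
  shows "(\<lambda>m. (coord x m)\<^sup>2) sums ((r [])\<^sup>2 / 2)"
proof -
  have "(\<lambda>i. (r (history x i))\<^sup>2 / 2) \<longlonglongrightarrow> 0\<^sup>2 / 2"
    by (intro tendsto_intros r_vanish assms) simp
  from telescope_sums'[OF this] have
    "(\<lambda>i. (edge (history x (Suc i)))\<^sup>2) sums ((r [])\<^sup>2 / 2)"
    unfolding edge_history_sq[OF assms] by simp
  then have "(\<lambda>i. (coord x (list_encode (history x (Suc i))))\<^sup>2) sums ((r [])\<^sup>2 / 2)"
    unfolding coord_code by simp
  then show ?thesis
    by (subst (asm) sums_mono_reindex[OF strict_mono_code]) (simp_all add: coord_off_code)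
qed

lemma ell2_nth_point: "x \<in> branches Ch \<Longrightarrow> ell2_nth (point x) = coord x"
  unfolding point_def using coord_sums[of x] by (subst Abs_ell2_inverse) (auto simp: sums_iff)

lemma inner_point_self: "x \<in> branches Ch \<Longrightarrow> inner (point x) (point x) = (r [])\<^sup>2 / 2"
  using coord_sums[of x] by (simp add: inner_ell2_def ell2_nth_point sums_iff power2_eq_square)

lemma inner_point_point:
  assumes x: "x \<in> branches Ch" and y: "y \<in> branches Ch"
    and eq: "history x j = history y j" and neq: "x j \<noteq> y j"
  shows "inner (point x) (point y) = (r [])\<^sup>2 / 2 - (r (history x j))\<^sup>2 / 2"
proof -
  have common: "history x (Suc i) = history y (Suc i) \<longleftrightarrow> i < j" for i
  proof
    assume "history x (Suc i) = history y (Suc i)"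
    then have "\<forall>k<Suc i. x k = y k"
      by (simp only: history_eq_iff)
    with neq show "i < j"
      by (meson not_less_eq)
  next
    assume "i < j"
    then show "history x (Suc i) = history y (Suc i)"
      using eq by (auto simp: history_eq_iff less_Suc_eq)
  qed
  have "(\<lambda>i. if i < j then (edge (history x (Suc i)))\<^sup>2 else 0) sums
          (\<Sum>i<j. (edge (history x (Suc i)))\<^sup>2)"
    using sums_If_finite_set[of "{..<j}" "\<lambda>i. (edge (history x (Suc i)))\<^sup>2"] by simp
  moreover have "(\<Sum>i<j. (edge (history x (Suc i)))\<^sup>2) = (r [])\<^sup>2 / 2 - (r (history x j))\<^sup>2 / 2"
    unfolding edge_history_sq[OF x]
    using sum_lessThan_telescope'[of "\<lambda>i. (r (history x i))\<^sup>2 / 2" j] by simp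
  moreover have "coord x (list_encode (history x (Suc i))) * coord y (list_encode (history x (Suc i)))
      = (if i < j then (edge (history x (Suc i)))\<^sup>2 else 0)" for i
    unfolding coord_code common by (simp add: power2_eq_square)
  ultimately have "(\<lambda>i. coord x (list_encode (history x (Suc i))) *
        coord y (list_encode (history x (Suc i)))) sums ((r [])\<^sup>2 / 2 - (r (history x j))\<^sup>2 / 2)"
    by simp
  then have "(\<lambda>m. coord x m * coord y m) sums ((r [])\<^sup>2 / 2 - (r (history x j))\<^sup>2 / 2)"
    by (subst (asm) sums_mono_reindex[OF strict_mono_code, where f = "\<lambda>m. coord x m * coord y m"])
       (simp_all add: coord_off_code)
  then show ?thesis
    by (simp add: inner_ell2_def ell2_nth_point x y sums_iff)
qed

lemma dist_point:
  assumes "x \<in> branches Ch" "y \<in> branches Ch" "history x j = history y j" "x j \<noteq> y j"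
  shows "dist (point x) (point y) = r (history x j)"
proof -
  have "(dist (point x) (point y))\<^sup>2 =
      inner (point x) (point x) + inner (point y) (point y) - 2 * inner (point x) (point y)"
    by (simp add: dist_norm power2_norm_eq_inner inner_diff inner_commute)
  also have "\<dots> = (r (history x j))\<^sup>2"
    using assms by (simp add: inner_point_self inner_point_point)
  finally show ?thesis
    using r_pos[of "history x j"] by (simp add: power2_eq_iff_nonneg)
qed

lemma r_antimono_history:
  assumes "x \<in> branches Ch" "i \<le> j"
  shows "r (history x j) \<le> r (history x i)"
proof (rule lift_Suc_antimono_le[of "\<lambda>j. r (history x j)", OF _ assms(2)])
  show "r (history x (Suc n)) \<le> r (history x n)" for n
    using assms(1) by (auto simp: branches_def intro: r_mono)
qed

lemma first_difference:
  fixes x y :: "nat \<Rightarrow> nat"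
  assumes "x \<noteq> y"
  obtains j where "history x j = history y j" "x j \<noteq> y j"
proof -
  from assms have "\<exists>j. x j \<noteq> y j"
    by auto
  then obtain j where "x j \<noteq> y j" "\<forall>i<j. x i = y i"
    using exists_least_iff[of "\<lambda>j. x j \<noteq> y j", THEN iffD1] by blast
  then show thesis
    by (intro that[of j]) (auto simp: history_eq_iff)
qed

text \<open>Two branches through \<open>\<tau>\<close> split at \<open>\<tau>\<close> or later, where the radius is no larger.\<close>

lemma dist_in_cylinder:
  assumes "p \<in> cylinder \<tau>" "q \<in> cylinder \<tau>"
  shows "dist p q \<le> r \<tau>"
proof -
  from assms obtain x y where xy: "x \<in> branches Ch" "y \<in> branches Ch"
      "history x (length \<tau>) = \<tau>" "history y (length \<tau>) = \<tau>" "p = point x" "q = point y"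
    by (auto simp: cylinder_def)
  show ?thesis
  proof (cases "x = y")
    case True
    then show ?thesis
      using xy r_pos[of \<tau>] by simp
  next
    case False
    then obtain j where j: "history x j = history y j" "x j \<noteq> y j"
      by (rule first_difference)
    have "length \<tau> \<le> j"
      using xy(3,4) j(2) history_eq_iff[of x "length \<tau>" y] by (metis not_le)
    then have "r (history x j) \<le> r \<tau>"
      using r_antimono_history[OF xy(1)] xy(3) by metis
    then show ?thesis
      using dist_point[OF xy(1,2) j] xy by simp
  qed
qed

lemma bounded_cylinder: "bounded (cylinder \<tau>)"
  unfolding bounded_two_points using dist_in_cylinder by blast

lemma diameter_cylinder: "diameter (cylinder \<tau>) \<le> r \<tau>"
  using r_pos[of \<tau>] by (intro diameter_le) (auto intro: dist_in_cylinder simp flip: dist_norm)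

lemma limit_set_subset_cylinders: "limit_set \<subseteq> (\<Union>\<tau>\<in>level Ch j. cylinder \<tau>)"
proof
  fix p assume "p \<in> limit_set"
  then obtain x where "x \<in> branches Ch" "p = point x"
    by (auto simp: limit_set_def)
  then show "p \<in> (\<Union>\<tau>\<in>level Ch j. cylinder \<tau>)"
    using node_history[of x Ch j]
    by (intro UN_I[of "history x j"]) (auto simp: level_def cylinder_def)
qed

text \<open>If \<open>C\<close> contains two points of the tree, take the first node where branches in \<open>C\<close> split: the
  distance of two points that split there is its radius. If \<open>C\<close> contains a single point of
  the tree, there is no such node, and the second alternative encloses the point in a cylinder of small
  weight.\<close>

lemma small_node_enclosing:
  fixes w :: "nat list \<Rightarrow> real"
  assumes C: "bounded C" and x: "x \<in> branches Ch" "point x \<in> C"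
    and w: "(\<lambda>j. w (history x j)) \<longlonglongrightarrow> 0" and e: "0 < e"
  obtains j where "\<And>y. y \<in> branches Ch \<Longrightarrow> point y \<in> C \<Longrightarrow> history y j = history x j"
    and "r (history x j) \<le> diameter C \<or> w (history x j) < e"
proof -
  define S where "S = {y \<in> branches Ch. point y \<in> C}"
  show thesis
  proof (cases "S = {x}")
    case True
    from order_tendstoD(2)[OF w e] obtain j where "w (history x j) < e"
      by (auto simp: eventually_sequentially)
    with True show thesis
      by (intro that[of j]) (auto simp: S_def)
  next
    case False
    moreover have "x \<in> S"
      using x by (simp add: S_def)
    ultimately obtain z where "z \<in> S" "z \<noteq> x"
      by blast
    then have "\<exists>j. \<exists>y\<in>S. y j \<noteq> x j"
      by (metis ext)
    then obtain j where j: "\<exists>y\<in>S. y j \<noteq> x j" and least: "\<forall>i<j. \<forall>y\<in>S. y i = x i"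
      using exists_least_iff[of "\<lambda>j. \<exists>y\<in>S. y j \<noteq> x j", THEN iffD1] by blast
    from j obtain y where y: "y \<in> S" "y j \<noteq> x j" by blast
    have same: "history z j = history x j" if "z \<in> S" for z
      using least that by (auto simp: history_eq_iff)
    have "r (history x j) = dist (point x) (point y)"
      using x y same[OF y(1)] by (intro dist_point[symmetric]) (auto simp: S_def)
    also have "\<dots> \<le> diameter C"
      using C x y by (intro diameter_bounded_bound) (auto simp: S_def)
    finally show thesis
      by (intro that[of j]) (use same in \<open>simp_all add: S_def\<close>)
  qed
qed

text \<open>Replace each set of the cover by an enclosing cylinder. The price for the sets that contain a single
  point is an arbitrary \<open>e > 0\<close>, spread geometrically over the cover. If the bounds \<open>b n\<close>
  summed to less than \<open>w []\<close>, some branch would avoid all these cylinders.\<close>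

lemma mass_distribution:
  fixes w :: "nat list \<Rightarrow> real" and b :: "nat \<Rightarrow> ennreal"
  assumes nonneg: "\<And>\<tau>. 0 \<le> w \<tau>"
    and split: "\<And>\<tau>. w \<tau> \<le> (\<Sum>i\<in>Ch \<tau>. w (i # \<tau>))"
    and w: "\<And>x. x \<in> branches Ch \<Longrightarrow> (\<lambda>j. w (history x j)) \<longlonglongrightarrow> 0"
    and cover: "limit_set \<subseteq> (\<Union>n. C n)" and bdd: "\<And>n. bounded (C n)"
    and b: "\<And>n \<tau>. node Ch \<tau> \<Longrightarrow> r \<tau> \<le> diameter (C n) \<Longrightarrow> ennreal (w \<tau>) \<le> b n"
  shows "ennreal (w []) \<le> (\<Sum>n. b n)"
proof (rule ccontr)
  assume "\<not> ennreal (w []) \<le> (\<Sum>n. b n)"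
  then have less: "(\<Sum>n. b n) < ennreal (w [])" by simp
  then have "0 < ennreal (w []) - (\<Sum>n. b n)"
    by (simp add: diff_gt_0_iff_gt_ennreal)
  then obtain z where z: "0 < z" "z < ennreal (w []) - (\<Sum>n. b n)"
    using dense by blast
  then obtain e where e: "0 < e" "ennreal e < ennreal (w []) - (\<Sum>n. b n)"
    by (cases z) auto
  have "(\<Sum>n. ennreal (e * (1/2) ^ Suc n)) = ennreal e"
  proof -
    have "(\<lambda>n. e * (1/2) ^ Suc n) sums e"
      using sums_mult[OF power_half_series, of e] by simp
    then show ?thesis
      using e(1) by (intro suminf_ennreal_eq) auto
  qed
  then have "(\<Sum>n. b n + ennreal (e * (1/2) ^ Suc n)) = (\<Sum>n. b n) + ennreal e"
    by (subst suminf_add[symmetric]) auto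
  also have "\<dots> < ennreal (w [])"
    using e(2) less by (subst (asm) less_diff_eq_ennreal) (auto simp: add.commute)
  finally have total: "(\<Sum>n. b n + ennreal (e * (1/2) ^ Suc n)) < ennreal (w [])" .
  define I where "I = {n. \<exists>x\<in>branches Ch. point x \<in> C n}"
  have "\<exists>\<tau>. (\<forall>y\<in>branches Ch. point y \<in> C n \<longrightarrow> history y (length \<tau>) = \<tau>) \<and>
      ennreal (w \<tau>) \<le> b n + ennreal (e * (1/2) ^ Suc n)" if "n \<in> I" for n
  proof -
    from that obtain x where x: "x \<in> branches Ch" "point x \<in> C n"
      by (auto simp: I_def)
    have pos: "0 < e * (1/2) ^ Suc n"
      using e(1) by simp
    obtain j where j: "\<And>y. y \<in> branches Ch \<Longrightarrow> point y \<in> C n \<Longrightarrow> history y j = history x j"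
      and small: "r (history x j) \<le> diameter (C n) \<or> w (history x j) < e * (1/2) ^ Suc n"
      using small_node_enclosing[OF bdd x w[OF x(1)] pos] by blast
    have "ennreal (w (history x j)) \<le> b n + ennreal (e * (1/2) ^ Suc n)"
      using small
    proof
      assume "r (history x j) \<le> diameter (C n)"
      then show ?thesis
        using b[OF node_history[OF x(1)]] by (simp add: add_increasing2)
    next
      assume "w (history x j) < e * (1/2) ^ Suc n"
      then show ?thesis
        by (intro add_increasing ennreal_leI) auto
    qed
    with j show ?thesis
      by (intro exI[of _ "history x j"]) auto
  qed
  then obtain \<sigma> where
    \<sigma>: "\<And>n y. n \<in> I \<Longrightarrow> y \<in> branches Ch \<Longrightarrow> point y \<in> C n \<Longrightarrow> history y (length (\<sigma> n)) = \<sigma> n"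
    and w_\<sigma>: "\<And>n. n \<in> I \<Longrightarrow> ennreal (w (\<sigma> n)) \<le> b n + ennreal (e * (1/2) ^ Suc n)"
    by metis
  obtain x where x: "x \<in> branches Ch" "\<And>n j. n \<in> I \<Longrightarrow> history x j \<noteq> \<sigma> n"
    using branch_avoiding_nodes[where Ch = Ch and w = w and \<sigma> = \<sigma> and I = I,
        OF finite_Ch nonneg split w_\<sigma> total]
    by blast
  have "point x \<in> limit_set"
    using x(1) by (simp add: limit_set_def)
  with cover obtain n where "point x \<in> C n" by blast
  with x(1) have "n \<in> I" by (auto simp: I_def)
  with \<sigma>[OF this x(1) \<open>point x \<in> C n\<close>] x(2) show False by blast
qed

text \<open>Finitely many nodes lie above level \<open>L\<close>, so their radii have a positive minimum.\<close>

lemma separation_by_level: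
  obtains \<delta> where "0 < \<delta>" "\<And>\<tau>. node Ch \<tau> \<Longrightarrow> r \<tau> < \<delta> \<Longrightarrow> L \<le> length \<tau>"
proof -
  define A where "A = insert 1 (r ` (\<Union>j<L. level Ch j))"
  have A: "finite A" "A \<noteq> {}"
    by (auto simp: A_def intro: finite_level finite_Ch)
  show thesis
  proof (rule that[of "Min A"])
    show "0 < Min A"
      using A r_pos by (auto simp: A_def)
    fix \<tau> assume "node Ch \<tau>" "r \<tau> < Min A"
    then have "r \<tau> \<notin> A"
      using A by (meson Min_le not_le)
    with \<open>node Ch \<tau>\<close> show "L \<le> length \<tau>"
      by (auto simp: A_def level_def not_less[symmetric])
  qed
qed

text \<open>The cylinders of one level, numbered by the codes of their nodes and padded with empty sets.\<close>

lemma cover_by_level: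
  assumes \<phi>: "mono_on {0..} \<phi>" "\<phi> 0 = 0" and R: "\<And>\<tau>. \<tau> \<in> level Ch j \<Longrightarrow> r \<tau> \<le> R" "0 \<le> R"
  obtains C :: "nat \<Rightarrow> ell2 set"
  where "limit_set \<subseteq> (\<Union>n. C n)" "\<And>n. bounded (C n)" "\<And>n. diameter (C n) \<le> R"
    and "(\<Sum>n. ennreal (\<phi> (diameter (C n)))) \<le> of_nat (card (level Ch j)) * ennreal (\<phi> R)"
proof -
  define C where "C n = (if list_decode n \<in> level Ch j then cylinder (list_decode n) else {})" for n
  have diam: "diameter (C n) \<le> R" for n
    using R(1)[of "list_decode n"] R(2) diameter_cylinder[of "list_decode n"] by (auto simp: C_def)
  have bdd: "bounded (C n)" for n
    by (simp add: C_def bounded_cylinder)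
  have cover: "limit_set \<subseteq> (\<Union>n. C n)"
  proof
    fix p assume "p \<in> limit_set"
    then obtain \<tau> where "\<tau> \<in> level Ch j" "p \<in> cylinder \<tau>"
      using limit_set_subset_cylinders[of j] by blast
    then show "p \<in> (\<Union>n. C n)"
      by (intro UN_I[of "list_encode \<tau>"]) (auto simp: C_def)
  qed
  define N where "N = list_encode ` level Ch j"
  have "finite N"
    by (simp add: N_def finite_level finite_Ch)
  moreover have "ennreal (\<phi> (diameter (C n))) = 0" if "n \<notin> N" for n
  proof -
    have "list_decode n \<notin> level Ch j"
      using that by (metis N_def image_eqI list_decode_inverse)
    then show ?thesis
      by (simp add: C_def \<phi>(2))
  qed
  ultimately have "(\<Sum>n. ennreal (\<phi> (diameter (C n)))) = (\<Sum>n\<in>N. ennreal (\<phi> (diameter (C n))))"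
    by (rule suminf_finite)
  also have "\<dots> \<le> of_nat (card N) * ennreal (\<phi> R)"
    using diam bdd R(2)
    by (intro sum_bounded_above ennreal_leI mono_onD[OF \<phi>(1)]) (auto intro: diameter_ge_0)
  also have "card N = card (level Ch j)"
    unfolding N_def by (intro card_image inj_on_subset[OF inj_list_encode]) auto
  finally show thesis
    using cover bdd diam by (intro that[of C]) auto
qed

end

section \<open>Fine covers and Hausdorff measures\<close>

lemma hausdorff_measure_fine_cover:
  assumes "hausdorff_measure \<phi> E < K" "0 < \<delta>"
  obtains C where "E \<subseteq> (\<Union>n. C n)" "\<And>n::nat. bounded (C n)" "\<And>n. diameter (C n) < \<delta>"
    and "(\<Sum>n. ennreal (\<phi> (diameter (C n)))) < K"
proof -
  have "(INF C\<in>{C :: nat \<Rightarrow> 'a set. E \<subseteq> (\<Union>n. C n) \<and> (\<forall>n. bounded (C n) \<and> diameter (C n) < \<delta>)}.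
      \<Sum>n. ennreal (\<phi> (diameter (C n)))) \<le> hausdorff_measure \<phi> E"
    unfolding hausdorff_measure_def using assms(2) by (intro SUP_upper) simp
  also note assms(1)
  finally obtain C :: "nat \<Rightarrow> 'a set" where
      "E \<subseteq> (\<Union>n. C n) \<and> (\<forall>n. bounded (C n) \<and> diameter (C n) < \<delta>)"
      "(\<Sum>n. ennreal (\<phi> (diameter (C n)))) < K"
    unfolding INF_less_iff by (elim bexE) (simp only: mem_Collect_eq)
  then show thesis
    by (intro that[of C]) simp_all
qed

lemma hausdorff_measure_eq_0I:
  assumes "\<And>\<delta> e. 0 < \<delta> \<Longrightarrow> 0 < e \<Longrightarrow> \<exists>C :: nat \<Rightarrow> 'a::metric_space set.
      E \<subseteq> (\<Union>n. C n) \<and> (\<forall>n. bounded (C n) \<and> diameter (C n) < \<delta>) \<and>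
      (\<Sum>n. ennreal (\<phi> (diameter (C n)))) \<le> e"
  shows "hausdorff_measure \<phi> E = 0"
proof -
  have "hausdorff_measure \<phi> E \<le> e" if "0 < e" for e
    unfolding hausdorff_measure_def
  proof (rule SUP_least)
    fix \<delta> :: real assume "\<delta> \<in> {0<..}"
    with assms[of \<delta> e] that show "(INF C\<in>{C :: nat \<Rightarrow> 'a set. E \<subseteq> (\<Union>n. C n) \<and>
        (\<forall>n. bounded (C n) \<and> diameter (C n) < \<delta>)}. \<Sum>n. ennreal (\<phi> (diameter (C n)))) \<le> e"
      by (auto intro: INF_lower2)
  qed
  then show ?thesis
    using dense[of 0 "hausdorff_measure \<phi> E"] by (metis leD not_gr_zero)
qed

lemma hausdorff_null_subset_sigma_finite: "hausdorff_null \<phi> \<subseteq> hausdorff_sigma_finite \<phi>"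
proof
  fix E :: "'a set" assume "E \<in> hausdorff_null \<phi>"
  then show "E \<in> hausdorff_sigma_finite \<phi>"
    unfolding hausdorff_null_def hausdorff_sigma_finite_def
    by (intro CollectI exI[of _ "\<lambda>_. E"]) auto
qed

lemma decr_null_seqs_less: "s \<in> decr_null_seqs \<Longrightarrow> 1 \<le> m \<Longrightarrow> m < n \<Longrightarrow> s n < s m"
  by (simp add: decr_null_seqs_def)

lemma decr_null_seqs_le: "s \<in> decr_null_seqs \<Longrightarrow> 1 \<le> m \<Longrightarrow> m \<le> n \<Longrightarrow> s n \<le> s m"
  using decr_null_seqs_less[of s m n] by (cases "m = n") auto

lemma decr_null_seqs_pos: "s \<in> decr_null_seqs \<Longrightarrow> 1 \<le> n \<Longrightarrow> 0 < s n"
  by (simp add: decr_null_seqs_def)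

lemma gauge_mono: "hausdorff_gauge \<phi> \<Longrightarrow> 0 \<le> a \<Longrightarrow> a \<le> b \<Longrightarrow> \<phi> a \<le> \<phi> b"
  by (rule mono_onD[of "{0..}"]) (auto simp: hausdorff_gauge_def)

lemma gauge_pos: "hausdorff_gauge \<phi> \<Longrightarrow> 0 < a \<Longrightarrow> 0 < \<phi> a"
  by (simp add: hausdorff_gauge_def)

lemma gauge_seq_nonneg:
  assumes "hausdorff_gauge \<phi>" "s \<in> decr_null_seqs" "1 \<le> n"
  shows "0 \<le> \<phi> (s n)"
  using gauge_pos[OF assms(1) decr_null_seqs_pos[OF assms(2,3)]] by simp

lemma gauge_seq_mono:
  assumes "hausdorff_gauge \<phi>" "s \<in> decr_null_seqs" "1 \<le> m" "m \<le> n"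
  shows "\<phi> (s n) \<le> \<phi> (s m)"
  using decr_null_seqs_pos[of s n] decr_null_seqs_le[of s m n] gauge_mono[of \<phi> "s n" "s m"] assms
  by simp

section \<open>Gauges with convergent sum: a null set that is not dominated\<close>

lemma ennreal_suminf_commute:
  fixes f :: "nat \<Rightarrow> nat \<Rightarrow> ennreal"
  shows "(\<Sum>n. \<Sum>j. f n j) = (\<Sum>j. \<Sum>n. f n j)"
proof -
  have "(\<Sum>n. \<Sum>j. f n j) = (\<integral>\<^sup>+n. (\<Sum>j. f n j) \<partial>count_space UNIV)"
    by (rule nn_integral_count_space_nat[symmetric])
  also have "\<dots> = (\<Sum>j. \<integral>\<^sup>+n. f n j \<partial>count_space UNIV)"
    by (rule nn_integral_suminf) simp
  finally show ?thesis
    by (simp add: nn_integral_count_space_nat)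
qed

text \<open>The numbers \<open>8 ^ j\<close> and \<open>(1/16) ^ j\<close> below are chosen so that both estimates are geometric: level
  \<open>j\<close> has \<open>2 ^ q j * 8 ^ j\<close> nodes and gives a cover with \<open>\<phi>\<close>-sum at most \<open>8 ^ j * (1/16) ^ j\<close>,
  while \<open>2 ^ q j\<close> cylinders of level \<open>j\<close> have total weight \<open>(1/8) ^ j\<close>.\<close>

lemma null_set_not_dominated:
  assumes \<phi>: "hausdorff_gauge \<phi>" and s: "s \<in> decr_null_seqs"
    and sum: "summable (\<lambda>n. \<phi> (s (Suc n)))"
  obtains E :: "ell2 set" where "E \<in> hausdorff_null \<phi>" "E \<notin> dominated_sets (mult_subseqs s)"
proof -
  define a where "a n = (if n = 0 then 0 else \<phi> (s n))" for n
  have "summable a"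
    using sum by (subst summable_Suc_iff[symmetric]) (simp add: a_def)
  moreover have "a (Suc m) \<le> a m" if "0 < m" for m
    using that gauge_seq_mono[OF \<phi> s, of m "Suc m"] by (simp add: a_def)
  moreover have "0 \<le> a n" for n
    using gauge_seq_nonneg[OF \<phi> s, of n] by (simp add: a_def)
  ultimately have "summable (\<lambda>n. 2 ^ n * a (2 ^ n))"
    using condensation_test[of a] by blast
  then have "(\<lambda>n. 2 ^ n * a (2 ^ n)) \<longlonglongrightarrow> 0"
    by (rule summable_LIMSEQ_zero)
  then have c0: "(\<lambda>n. 2 ^ n * \<phi> (s (2 ^ n))) \<longlonglongrightarrow> 0"
    by (simp add: a_def)
  have "\<exists>q :: nat \<Rightarrow> nat. \<forall>j. (if j = 0 then q j = 0 else 2 ^ q j * \<phi> (s (2 ^ q j)) \<le> (1/16) ^ j) \<and>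
      q j < q (Suc j)"
  proof (rule dependent_nat_choice)
    fix m j :: nat
    have "\<forall>\<^sub>F n in sequentially. 2 ^ n * \<phi> (s (2 ^ n)) < (1/16) ^ Suc j"
      by (rule order_tendstoD(2)[OF c0]) simp
    then have "\<forall>\<^sub>F n in sequentially. m < n \<and> 2 ^ n * \<phi> (s (2 ^ n)) < (1/16) ^ Suc j"
      by (intro eventually_conj eventually_gt_at_top)
    then obtain n where "m < n" "2 ^ n * \<phi> (s (2 ^ n)) < (1/16) ^ Suc j"
      using eventually_happens trivial_limit_sequentially by blast
    then show "\<exists>n. (if Suc j = 0 then n = 0 else 2 ^ n * \<phi> (s (2 ^ n)) \<le> (1/16) ^ Suc j) \<and> m < n"
      by (intro exI[of _ n]) auto
  qed simp
  then obtain q :: "nat \<Rightarrow> nat" where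
    q_spec: "\<And>j. if j = 0 then q j = 0 else 2 ^ q j * \<phi> (s (2 ^ q j)) \<le> (1/16) ^ j"
    and q_less: "\<And>j. q j < q (Suc j)"
    by blast
  have q0: "q 0 = 0"
    using q_spec[of 0] by simp
  have q: "2 ^ q j * \<phi> (s (2 ^ q j)) \<le> (1/16) ^ j" if "0 < j" for j
    using q_spec[of j] that by simp
  have q_mono: "strict_mono q"
    using q_less by (simp add: strict_mono_Suc_iff)
  define p where "p j = q j + 3 * j" for j
  define Ch where "Ch \<tau> = {..<2 ^ (p (Suc (length \<tau>)) - p (length \<tau>)) :: nat}" for \<tau> :: "nat list"
  define r where "r \<tau> = s (2 ^ q (length \<tau>))" for \<tau> :: "nat list"
  define w where "w \<tau> = (1/2 :: real) ^ p (length \<tau>)" for \<tau> :: "nat list"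
  have p_less: "p j < p (Suc j)" for j
    using q_less[of j] by (simp add: p_def)
  have s_q: "(\<lambda>j. s (2 ^ q j)) \<longlonglongrightarrow> 0"
  proof -
    have "strict_mono (\<lambda>j. 2 ^ q j :: nat)"
      using q_less by (simp add: strict_mono_Suc_iff)
    moreover have "s \<longlonglongrightarrow> 0"
      using s by (simp add: decr_null_seqs_def)
    ultimately show ?thesis
      using LIMSEQ_subseq_LIMSEQ[of s 0 "\<lambda>j. 2 ^ q j"] by (simp add: o_def)
  qed
  interpret ultrametric_tree Ch r
  proof
    show "r (i # \<tau>) \<le> r \<tau>" for i \<tau>
      using q_less[of "length \<tau>"] by (auto simp: r_def intro!: decr_null_seqs_le[OF s])
    show "0 < r \<tau>" for \<tau>
      by (simp add: r_def decr_null_seqs_pos[OF s])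
  qed (simp_all add: Ch_def r_def s_q)
  have card: "card (level Ch j) = 2 ^ p j" for j
  proof (induction j)
    case 0
    show ?case by (simp add: level_0 p_def q0)
  next
    case (Suc j)
    have "card (level Ch (Suc j)) = card (SIGMA \<tau>:level Ch j. Ch \<tau>)"
      unfolding level_Suc by (intro card_image) (auto simp: inj_on_def)
    also have "\<dots> = (\<Sum>\<tau>\<in>level Ch j. card (Ch \<tau>))"
      by (simp add: card_SigmaI finite_level finite_Ch)
    also have "\<dots> = (\<Sum>\<tau>\<in>level Ch j. 2 ^ (p (Suc j) - p j))"
      by (intro sum.cong) (auto simp: Ch_def level_def)
    also have "\<dots> = 2 ^ p (Suc j)"
      using Suc p_less[of j] by (simp flip: power_add)
    finally show ?case .
  qed
  have "hausdorff_measure \<phi> limit_set = 0"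
  proof (rule hausdorff_measure_eq_0I)
    fix \<delta> :: real and e :: ennreal assume \<delta>: "0 < \<delta>" and e: "0 < e"
    have "(\<lambda>j. ennreal ((1/2) ^ j)) \<longlonglongrightarrow> ennreal 0"
      by (intro tendsto_ennrealI LIMSEQ_realpow_zero) auto
    then have "\<forall>\<^sub>F j in sequentially. ennreal ((1/2) ^ j) < e"
      using e by (intro order_tendstoD(2)) auto
    moreover have "\<forall>\<^sub>F j in sequentially. s (2 ^ q j) < \<delta>"
      using s_q \<delta> by (rule order_tendstoD(2))
    moreover have "\<forall>\<^sub>F j in sequentially. 0 < (j::nat)"
      by (rule eventually_gt_at_top)
    ultimately have "\<forall>\<^sub>F j in sequentially. ennreal ((1/2) ^ j) < e \<and> s (2 ^ q j) < \<delta> \<and> 0 < j"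
      by (intro eventually_conj)
    then obtain j where j: "ennreal ((1/2) ^ j) < e" "s (2 ^ q j) < \<delta>" "0 < j"
      using eventually_happens trivial_limit_sequentially by blast
    have "(2::real) ^ p j * \<phi> (s (2 ^ q j)) = 8 ^ j * (2 ^ q j * \<phi> (s (2 ^ q j)))"
      by (simp add: p_def power_add power_mult)
    also have "\<dots> \<le> 8 ^ j * (1/16) ^ j"
      using q[OF j(3)] by (intro mult_left_mono) auto
    also have "\<dots> = (1/2) ^ j"
      by (simp flip: power_mult_distrib)
    finally have small: "2 ^ p j * \<phi> (s (2 ^ q j)) \<le> (1/2) ^ j" .
    obtain C where C: "limit_set \<subseteq> (\<Union>n. C n)" "\<And>n. bounded (C n)" "\<And>n. diameter (C n) \<le> s (2 ^ q j)"
        "(\<Sum>n. ennreal (\<phi> (diameter (C n)))) \<le> of_nat (card (level Ch j)) * ennreal (\<phi> (s (2 ^ q j)))"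
    proof (rule cover_by_level[of \<phi> j "s (2 ^ q j)"])
      show "mono_on {0..} \<phi>" "\<phi> 0 = 0"
        using \<phi> by (auto simp: hausdorff_gauge_def)
      show "0 \<le> s (2 ^ q j)"
        using decr_null_seqs_pos[OF s, of "2 ^ q j"] by simp
    qed (auto simp: r_def level_def)
    have "of_nat (card (level Ch j)) * ennreal (\<phi> (s (2 ^ q j))) = ennreal (2 ^ p j * \<phi> (s (2 ^ q j)))"
      by (simp add: card ennreal_mult' flip: ennreal_numeral ennreal_power)
    also have "\<dots> \<le> e"
      using ennreal_leI[OF small] j(1) by order
    finally have "(\<Sum>n. ennreal (\<phi> (diameter (C n)))) \<le> e"
      using C(4) by order
    moreover have "diameter (C n) < \<delta>" for n
      using C(3)[of n] j(2) by (rule le_less_trans)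
    ultimately show "\<exists>C :: nat \<Rightarrow> ell2 set. limit_set \<subseteq> (\<Union>n. C n) \<and>
        (\<forall>n. bounded (C n) \<and> diameter (C n) < \<delta>) \<and> (\<Sum>n. ennreal (\<phi> (diameter (C n)))) \<le> e"
      using C(1,2) by blast
  qed
  then have null: "limit_set \<in> hausdorff_null \<phi>"
    by (simp add: hausdorff_null_def)
  have "limit_set \<notin> dominated_sets (mult_subseqs s)"
  proof
    assume "limit_set \<in> dominated_sets (mult_subseqs s)"
    moreover have "s \<in> mult_subseqs s"
      by (auto simp: mult_subseqs_def intro!: exI[of _ 1])
    ultimately obtain C :: "nat \<Rightarrow> ell2 set" where C: "limit_set \<subseteq> (\<Union>n\<in>{1..}. C n)"
        "\<And>n. 1 \<le> n \<Longrightarrow> bounded (C n)" "\<And>n. 1 \<le> n \<Longrightarrow> diameter (C n) < s n"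
      unfolding dominated_sets_def dominated_by_def by blast
    (* A set of diameter less than s (Suc n) can only contain a splitting node of a level j with
       Suc n < 2 ^ q j. Adding the weights of all these levels is a crude bound for its mass,
       but for each j there are fewer than 2 ^ q j such n, which makes the double sum small. *)
    define f where "f n j = (if Suc n < 2 ^ q j then ennreal ((1/2) ^ p j) else 0)" for n j
    have "ennreal (w []) \<le> (\<Sum>n. \<Sum>j. f n j)"
    proof (rule mass_distribution[where C = "\<lambda>n. C (Suc n)"])
      show "0 \<le> w \<tau>" for \<tau>
        by (simp add: w_def)
      show "w \<tau> \<le> (\<Sum>i\<in>Ch \<tau>. w (i # \<tau>))" for \<tau>
      proof -
        obtain d where "p (Suc (length \<tau>)) = p (length \<tau>) + d"
          using p_less[of "length \<tau>"] less_imp_add_positive by metis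
        then show ?thesis
          by (simp add: w_def Ch_def power_one_over power_add)
      qed
      show "(\<lambda>j. w (history x j)) \<longlonglongrightarrow> 0" for x
      proof -
        have "strict_mono p"
          using p_less by (simp add: strict_mono_Suc_iff)
        moreover have "(\<lambda>j. (1/2 :: real) ^ j) \<longlonglongrightarrow> 0"
          by (intro LIMSEQ_realpow_zero) auto
        ultimately show ?thesis
          using LIMSEQ_subseq_LIMSEQ[of "\<lambda>j. (1/2 :: real) ^ j" 0 p] by (simp add: o_def w_def)
      qed
      show "limit_set \<subseteq> (\<Union>n. C (Suc n))"
      proof
        fix z assume "z \<in> limit_set"
        with C(1) obtain n where "1 \<le> n" "z \<in> C n" by auto
        then show "z \<in> (\<Union>n. C (Suc n))"
          by (intro UN_I[of "n - 1"]) auto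
      qed
      show "bounded (C (Suc n))" for n
        by (rule C(2)) simp
      show "ennreal (w \<tau>) \<le> (\<Sum>j. f n j)" if "r \<tau> \<le> diameter (C (Suc n))" for n \<tau>
      proof -
        have "s (2 ^ q (length \<tau>)) < s (Suc n)"
          using that C(3)[of "Suc n"] by (simp add: r_def)
        then have "Suc n < 2 ^ q (length \<tau>)"
          using decr_null_seqs_le[OF s, of "2 ^ q (length \<tau>)" "Suc n"] by (meson not_less one_le_numeral one_le_power)
        then have "ennreal (w \<tau>) = f n (length \<tau>)"
          by (simp add: f_def w_def)
        also have "\<dots> \<le> (\<Sum>j. f n j)"
          using sum_le_suminf[of "f n" "{length \<tau>}"] by simp
        finally show ?thesis .
      qed
    qed
    also have "\<dots> = (\<Sum>j. \<Sum>n. f n j)"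
      by (rule ennreal_suminf_commute)
    also have "\<dots> \<le> (\<Sum>j. ennreal ((1/2) ^ Suc j * (1/2)))"
    proof (intro suminf_le allI)
      fix j
      show "(\<Sum>n. f n j) \<le> ennreal ((1/2) ^ Suc j * (1/2))"
      (* For j = 0 there is no n with Suc n < 2 ^ 0; so the largest level weight, 1, is not paid. *)
      proof (cases "j = 0")
        case True
        then show ?thesis by (simp add: f_def q0)
      next
        case False
        have "(\<Sum>n. f n j) = (\<Sum>n<2 ^ q j. f n j)"
          by (intro suminf_finite) (auto simp: f_def)
        also have "\<dots> \<le> of_nat (card {..<(2::nat) ^ q j}) * ennreal ((1/2) ^ p j)"
          by (intro sum_bounded_above) (auto simp: f_def)
        also have "\<dots> = ennreal (2 ^ q j * (1/2) ^ p j)"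
          by (simp add: ennreal_mult' flip: ennreal_numeral ennreal_power)
        also have "2 ^ q j * (1/2) ^ p j = (1/2 :: real) ^ (3 * j)"
          by (simp add: p_def power_add flip: power_mult_distrib)
        also have "ennreal ((1/2) ^ (3 * j)) \<le> ennreal ((1/2) ^ (Suc j + 1))"
          using False by (intro ennreal_leI power_decreasing) auto
        finally show ?thesis by simp
      qed
    qed auto
    also have "\<dots> = ennreal (1/2)"
      using sums_mult2[OF power_half_series, of "1/2"] by (intro suminf_ennreal_eq) auto
    finally have "w [] \<le> 1/2"
      by (subst (asm) ennreal_le_iff) auto
    then show False
      by (simp add: w_def p_def q0)
  qed
  with null show thesis by (rule that)
qed

section \<open>Gauges with divergent sum: a dominated set of non-sigma-finite measure\<close>

text \<open>Compare each block of \<open>K\<close> consecutive terms with \<open>K\<close> times its first term.\<close>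

lemma not_summable_multiples:
  fixes a :: "nat \<Rightarrow> real"
  assumes nonneg: "\<And>n. 1 \<le> n \<Longrightarrow> 0 \<le> a n" and mono: "\<And>m n. 1 \<le> m \<Longrightarrow> m \<le> n \<Longrightarrow> a n \<le> a m"
    and div: "\<not> summable (\<lambda>n. a (Suc n))" and K: "1 \<le> K"
  shows "\<not> summable (\<lambda>n. a (K * Suc n))"
proof
  assume sum: "summable (\<lambda>n. a (K * Suc n))"
  have "summable (\<lambda>n. a (n + K))"
  proof (rule bounded_imp_summable)
    show "0 \<le> a (n + K)" for n
      using K by (intro nonneg) auto
    show "(\<Sum>k\<le>n. a (k + K)) \<le> K * (\<Sum>n. a (K * Suc n))" for n
    proof -
      have "(\<Sum>k\<le>n. a (k + K)) \<le> (\<Sum>k<Suc n * K. a (k + K))"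
      proof (rule sum_mono2)
        have "k < Suc n * K" if "k \<le> n" for k
        proof -
          have "k < Suc n * 1" using that by simp
          also have "\<dots> \<le> Suc n * K" using K by (intro mult_left_mono) auto
          finally show ?thesis .
        qed
        then show "{..n} \<subseteq> {..<Suc n * K}" by auto
      qed (use K in \<open>auto intro!: nonneg\<close>)
      also have "\<dots> = (\<Sum>m<Suc n. \<Sum>k\<in>{m * K..<m * K + K}. a (k + K))"
        by (rule sum.nat_group[symmetric])
      also have "\<dots> \<le> (\<Sum>m<Suc n. of_nat (card {m * K..<m * K + K}) * a (K * Suc m))"
        using K by (intro sum_mono sum_bounded_above mono) (auto simp: algebra_simps)
      also have "\<dots> = K * (\<Sum>m<Suc n. a (K * Suc m))"
        by (simp only: sum_distrib_left card_atLeastLessThan add_diff_cancel_left')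
      also have "\<dots> \<le> K * (\<Sum>m. a (K * Suc m))"
        using K by (intro mult_left_mono sum_le_suminf sum) (auto intro!: nonneg)
      finally show ?thesis .
    qed
  qed
  then have "summable a"
    by (simp only: summable_iff_shift)
  then have "summable (\<lambda>n. a (Suc n))"
    by (subst summable_Suc_iff)
  with div show False ..
qed

lemma not_summable_finite_sum_ge:
  fixes g :: "nat \<Rightarrow> real"
  assumes "\<And>i. 0 \<le> g i" "\<not> summable g"
  obtains I where "finite I" "I \<subseteq> {N..}" "B \<le> sum g I"
proof -
  have "\<not> summable (\<lambda>i. g (i + N))"
    using assms(2) by (simp add: summable_iff_shift)
  then obtain n where "B < (\<Sum>i\<le>n. g (i + N))"
    using bounded_imp_summable[of "\<lambda>i. g (i + N)" B] assms(1) by (meson not_le)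
  also have "(\<Sum>i\<le>n. g (i + N)) = sum g ((\<lambda>i. i + N) ` {..n})"
    by (subst sum.reindex) (auto simp: inj_on_def)
  finally show thesis
    by (intro that[of "(\<lambda>i. i + N) ` {..n}"]) auto
qed

text \<open>This splits the positive integers into disjoint arithmetic progressions, one for each exponent.\<close>

lemma power2_mult_odd_inject:
  fixes a b i j :: nat
  assumes "2 ^ a * (2 * i + 1) = 2 ^ b * (2 * j + 1)"
  shows "a = b \<and> i = j"
proof -
  have *: "a = b" if "2 ^ a * (2 * i + 1) = 2 ^ b * (2 * j + 1)" "a \<le> b" for a b i j :: nat
  proof (rule ccontr)
    assume "a \<noteq> b"
    with that(2) obtain c where c: "b = a + Suc c"
      by (metis le_neq_implies_less less_imp_Suc_add add_Suc_right)
    with that(1) have "2 ^ a * (2 * i + 1) = 2 ^ a * (2 * (2 ^ c * (2 * j + 1)))"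
      by (simp add: power_add algebra_simps)
    then have "2 * i + 1 = 2 * (2 ^ c * (2 * j + 1))"
      by (simp only: mult_cancel1) simp
    then show False
      by presburger
  qed
  have "a = b"
    using *[of a i b j] *[of b j a i] assms by (metis linear)
  with assms show ?thesis by simp
qed

text \<open>The children of \<open>\<tau>\<close> get the numbers \<open>2 ^ list_encode \<tau> * (2 * i + 1)\<close>. Thus different nodes of
  the same level have different numbers, although each family of siblings is chosen on its own:
  the numbers reserved for one family grow linearly in \<open>i\<close>, so the sum of \<open>\<phi>\<close> over the reserved
  radii diverges, and a finite part of it beyond any given position is as large as needed.\<close>

lemma dominated_set_not_sigma_finite:
  assumes \<phi>: "hausdorff_gauge \<phi>" and s: "s \<in> decr_null_seqs"
    and div: "\<not> summable (\<lambda>n. \<phi> (s (Suc n)))"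
  obtains E :: "ell2 set" where "E \<in> dominated_sets (mult_subseqs s)" "E \<notin> hausdorff_sigma_finite \<phi>"
proof -
  define idx where "idx \<tau> i = 2 ^ list_encode \<tau> * (2 * i + 1)" for \<tau> and i :: nat
  define r where "r \<tau> = (case \<tau> of [] \<Rightarrow> s 1 | i # \<tau>' \<Rightarrow> s (Suc (length \<tau>') * Suc (idx \<tau>' i)))" for \<tau>
  have r_Nil: "r [] = s 1" and r_Cons: "r (i # \<tau>) = s (Suc (length \<tau>) * Suc (idx \<tau> i))" for i \<tau>
    by (simp_all add: r_def)
  have idx_ge: "i < idx \<tau> i" for \<tau> i
  proof -
    have "1 * (2 * i + 1) \<le> idx \<tau> i"
      unfolding idx_def by (intro mult_right_mono) auto
    then show ?thesis by simp
  qed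
  have r_pos: "0 < r \<tau>" for \<tau>
    by (cases \<tau>) (auto simp: r_Nil r_Cons intro!: decr_null_seqs_pos[OF s])
  have r_Cons_le: "r (i # \<tau>) \<le> s (Suc i)" "r (i # \<tau>) \<le> s (Suc (length \<tau>))" for i \<tau>
  proof -
    have "Suc i \<le> 1 * Suc (idx \<tau> i)"
      using idx_ge[of i \<tau>] by simp
    also have "\<dots> \<le> Suc (length \<tau>) * Suc (idx \<tau> i)"
      by (intro mult_right_mono) auto
    finally show "r (i # \<tau>) \<le> s (Suc i)"
      unfolding r_Cons by (intro decr_null_seqs_le[OF s]) auto
    show "r (i # \<tau>) \<le> s (Suc (length \<tau>))"
      unfolding r_Cons by (intro decr_null_seqs_le[OF s]) auto
  qed
  have s_lim: "s \<longlonglongrightarrow> 0"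
    using s by (simp add: decr_null_seqs_def)
  have "\<exists>I. finite I \<and> (\<forall>i\<in>I. r (i # \<tau>) \<le> r \<tau>) \<and> 2 * \<phi> (r \<tau>) \<le> (\<Sum>i\<in>I. \<phi> (r (i # \<tau>)))" for \<tau>
  proof -
    have div_K: "\<not> summable (\<lambda>i. \<phi> (s (K * Suc i)))" if "1 \<le> K" for K
      by (rule not_summable_multiples[of "\<lambda>n. \<phi> (s n)"])
         (use that div gauge_seq_nonneg[OF \<phi> s] gauge_seq_mono[OF \<phi> s] in auto)
    (* The reserved number of the child i satisfies idx \<tau> i + 1 \<le> 2 ^ (list_encode \<tau> + 1) * (i + 1),
       so its radius is at least the term of s with index K * (i + 1). *)
    define K where "K = Suc (length \<tau>) * 2 ^ Suc (list_encode \<tau>)"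
    have "1 \<le> K"
      unfolding K_def by (metis One_nat_def Suc_leI nat_0_less_mult_iff zero_less_Suc zero_less_numeral zero_less_power)
    then have K: "1 \<le> K * Suc i" for i
      by simp
    have "\<phi> (s (K * Suc i)) \<le> \<phi> (r (i # \<tau>))" for i
    proof -
      have "Suc (idx \<tau> i) \<le> 2 ^ Suc (list_encode \<tau>) * Suc i"
        by (simp add: idx_def algebra_simps)
      then have "Suc (length \<tau>) * Suc (idx \<tau> i) \<le> Suc (length \<tau>) * (2 ^ Suc (list_encode \<tau>) * Suc i)"
        by (rule mult_left_mono) simp
      also have "\<dots> = K * Suc i"
        by (simp only: K_def mult.assoc)
      finally have "s (K * Suc i) \<le> r (i # \<tau>)"
        unfolding r_Cons by (intro decr_null_seqs_le[OF s]) auto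
      then show ?thesis
        by (intro gauge_mono[OF \<phi>] less_imp_le[OF decr_null_seqs_pos[OF s K]])
    qed
    moreover have "0 \<le> \<phi> (s (K * Suc i))" for i
      by (rule gauge_seq_nonneg[OF \<phi> s K])
    ultimately have "\<not> summable (\<lambda>i. \<phi> (r (i # \<tau>)))"
      using div_K[OF \<open>1 \<le> K\<close>] summable_comparison_test'[of "\<lambda>i. \<phi> (r (i # \<tau>))" 0 "\<lambda>i. \<phi> (s (K * Suc i))"]
      by auto
    moreover have "0 \<le> \<phi> (r (i # \<tau>))" for i
      by (intro less_imp_le gauge_pos[OF \<phi>] r_pos)
    moreover obtain N where N: "\<And>i. N \<le> i \<Longrightarrow> s i < r \<tau>"
      using order_tendstoD(2)[OF s_lim r_pos[of \<tau>]] by (auto simp: eventually_sequentially)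
    ultimately obtain I where I: "finite I" "I \<subseteq> {N..}" "2 * \<phi> (r \<tau>) \<le> (\<Sum>i\<in>I. \<phi> (r (i # \<tau>)))"
      using not_summable_finite_sum_ge[of "\<lambda>i. \<phi> (r (i # \<tau>))"] by metis
    have "r (i # \<tau>) \<le> r \<tau>" if "i \<in> I" for i
      using r_Cons_le(1)[of i \<tau>] N[of "Suc i"] that I(2) by force
    with I show ?thesis by blast
  qed
  then obtain Ch where Ch: "\<And>\<tau>. finite (Ch \<tau>)" "\<And>i \<tau>. i \<in> Ch \<tau> \<Longrightarrow> r (i # \<tau>) \<le> r \<tau>"
      "\<And>\<tau>. 2 * \<phi> (r \<tau>) \<le> (\<Sum>i\<in>Ch \<tau>. \<phi> (r (i # \<tau>)))"
    by metis
  interpret ultrametric_tree Ch r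
  proof
    show "(\<lambda>j. r (history x j)) \<longlonglongrightarrow> 0" for x
    proof (rule LIMSEQ_imp_Suc, rule tendsto_sandwich[of "\<lambda>_. 0" _ _ "\<lambda>j. s (Suc j)"])
      show "(\<lambda>j. s (Suc j)) \<longlonglongrightarrow> 0"
        using s_lim by (rule LIMSEQ_Suc)
      have "r (history x (Suc j)) \<le> s (Suc j)" for j
        using r_Cons_le(2)[of "x j" "history x j"] by simp
      then show "\<forall>\<^sub>F j in sequentially. r (history x (Suc j)) \<le> s (Suc j)"
        by (intro always_eventually allI)
      show "\<forall>\<^sub>F j in sequentially. 0 \<le> r (history x (Suc j))"
        by (intro always_eventually allI less_imp_le r_pos)
    qed auto
  qed (use Ch r_pos in auto)
  have "limit_set \<in> dominated_sets (mult_subseqs s)"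
    unfolding dominated_sets_def dominated_by_def
  proof (intro CollectI ballI)
    fix t assume "t \<in> mult_subseqs s"
    then obtain k where k: "1 \<le> k" and t: "t = (\<lambda>n. s (k * n))"
      by (auto simp: mult_subseqs_def)
    define C where "C n = (\<Union>{cylinder (i # \<tau>) | i \<tau>. idx \<tau> i = n \<and> Suc (length \<tau>) = k})" for n
    have C_idx: "C (idx \<tau> i) = cylinder (i # \<tau>)" if "Suc (length \<tau>) = k" for \<tau> i
    proof -
      have "\<tau>' = \<tau> \<and> i' = i" if "idx \<tau>' i' = idx \<tau> i" for \<tau>' i'
        using that power2_mult_odd_inject unfolding idx_def by (metis list_encode_eq)
      then have "{cylinder (i' # \<tau>') | i' \<tau>'. idx \<tau>' i' = idx \<tau> i \<and> Suc (length \<tau>') = k} = {cylinder (i # \<tau>)}"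
        using that by auto
      then show ?thesis
        by (simp add: C_def)
    qed
    have "limit_set \<subseteq> (\<Union>n\<in>{1..}. C n)"
    proof
      fix p assume "p \<in> limit_set"
      then obtain \<tau> where \<tau>: "\<tau> \<in> level Ch k" "p \<in> cylinder \<tau>"
        using limit_set_subset_cylinders[of k] by blast
      then obtain i \<tau>' where eq: "\<tau> = i # \<tau>'" "Suc (length \<tau>') = k"
        using k by (cases \<tau>) (auto simp: level_def)
      then have "p \<in> C (idx \<tau>' i)"
        using \<tau>(2) C_idx by simp
      then show "p \<in> (\<Union>n\<in>{1..}. C n)"
        using idx_ge[of i \<tau>'] by (intro UN_I[of "idx \<tau>' i"]) auto
    qed
    moreover have "bounded (C n) \<and> diameter (C n) < t n" if n: "1 \<le> n" for n
    proof (cases "\<exists>i \<tau>. idx \<tau> i = n \<and> Suc (length \<tau>) = k")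
      case True
      then obtain i \<tau> where i: "idx \<tau> i = n" "Suc (length \<tau>) = k" by blast
      then have "C n = cylinder (i # \<tau>)"
        using C_idx by blast
      moreover have "r (i # \<tau>) < t n"
        unfolding r_Cons i t using k n by (intro decr_null_seqs_less[OF s]) auto
      ultimately show ?thesis
        using diameter_cylinder[of "i # \<tau>"] by (auto simp: bounded_cylinder)
    next
      case False
      then have "C n = {}"
        by (auto simp: C_def)
      then show ?thesis
        using k n by (simp add: t decr_null_seqs_pos[OF s])
    qed
    ultimately show "\<exists>C. limit_set \<subseteq> (\<Union>n\<in>{1..}. C n) \<and> (\<forall>n\<ge>1. bounded (C n) \<and> diameter (C n) < t n)"
      by blast
  qed
  moreover have "limit_set \<notin> hausdorff_sigma_finite \<phi>"
  proof
    assume "limit_set \<in> hausdorff_sigma_finite \<phi>"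
    then obtain F where F: "limit_set = (\<Union>n::nat. F n)" "\<And>n. hausdorff_measure \<phi> (F n) < \<infinity>"
      by (auto simp: hausdorff_sigma_finite_def)
    (* Each F m is covered so finely that only nodes of level at least L m can split in a set
       of the cover. There the weight is at most (1/2) ^ L m times \<phi> of the diameter, and L m
       is chosen so large that F m costs at most the fraction (1/2) ^ Suc m of half the mass. *)
    define M where "M = \<phi> (r [])"
    have M: "0 < M"
      unfolding M_def by (rule gauge_pos[OF \<phi> r_pos])
    have "\<exists>L (C :: nat \<Rightarrow> ell2 set). F m \<subseteq> (\<Union>n. C n) \<and> (\<forall>n. bounded (C n)) \<and>
        (\<forall>n \<tau>. node Ch \<tau> \<longrightarrow> r \<tau> \<le> diameter (C n) \<longrightarrow> L \<le> length \<tau>) \<and>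
        ennreal ((1/2) ^ L) * (\<Sum>n. ennreal (\<phi> (diameter (C n)))) \<le> ennreal ((1/2) ^ Suc m * (M / 2))" for m
    proof -
      obtain B where B: "0 \<le> B" "hausdorff_measure \<phi> (F m) = ennreal B"
        using F(2)[of m] by (cases "hausdorff_measure \<phi> (F m)") auto
      have "0 < (1/2) ^ Suc m * (M / 2) / (B + 1)"
        using M B(1) by simp
      then obtain L where L: "(1/2) ^ L < (1/2) ^ Suc m * (M / 2) / (B + 1)"
        using real_arch_pow_inv[of _ "1/2 :: real"] by auto
      obtain \<delta> where \<delta>: "0 < \<delta>" "\<And>\<tau>. node Ch \<tau> \<Longrightarrow> r \<tau> < \<delta> \<Longrightarrow> L \<le> length \<tau>"
        using separation_by_level by blast
      have "hausdorff_measure \<phi> (F m) < ennreal (B + 1)"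
        using B by (simp add: ennreal_less_iff)
      then obtain C where C: "F m \<subseteq> (\<Union>n. C n)" "\<And>n::nat. bounded (C n)" "\<And>n. diameter (C n) < \<delta>"
          "(\<Sum>n. ennreal (\<phi> (diameter (C n)))) < ennreal (B + 1)"
        using hausdorff_measure_fine_cover[OF _ \<delta>(1)] by metis
      have "ennreal ((1/2) ^ L) * (\<Sum>n. ennreal (\<phi> (diameter (C n)))) \<le> ennreal ((1/2) ^ L) * ennreal (B + 1)"
        using C(4) by (intro mult_left_mono) auto
      also have "\<dots> = ennreal ((1/2) ^ L * (B + 1))"
        using B(1) by (simp add: ennreal_mult')
      also have "\<dots> \<le> ennreal ((1/2) ^ Suc m * (M / 2))"
      proof (rule ennreal_leI)
        show "(1/2) ^ L * (B + 1) \<le> (1/2) ^ Suc m * (M / 2)"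
          using B(1) L[THEN less_imp_le] by (subst (asm) pos_le_divide_eq) auto
      qed
      finally show ?thesis
        using C(1-3) \<delta>(2) by (meson order_le_less_trans)
    qed
    then obtain L and C :: "nat \<Rightarrow> nat \<Rightarrow> ell2 set" where C: "\<And>m. F m \<subseteq> (\<Union>n. C m n)"
        "\<And>m n. bounded (C m n)"
        "\<And>m n \<tau>. node Ch \<tau> \<Longrightarrow> r \<tau> \<le> diameter (C m n) \<Longrightarrow> L m \<le> length \<tau>"
        "\<And>m. ennreal ((1/2) ^ L m) * (\<Sum>n. ennreal (\<phi> (diameter (C m n)))) \<le> ennreal ((1/2) ^ Suc m * (M / 2))"
      by metis
    define w where "w \<tau> = (1/2) ^ length \<tau> * \<phi> (r \<tau>)" for \<tau>
    define b where "b = (\<lambda>(m, n). ennreal ((1/2) ^ L m) * ennreal (\<phi> (diameter (C m n))))"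
    have \<phi>_r: "0 \<le> \<phi> (r \<tau>)" for \<tau>
      by (intro less_imp_le gauge_pos[OF \<phi>] r_pos)
    have "ennreal (w []) \<le> (\<Sum>n. b (prod_decode n))"
    proof (rule mass_distribution[where C = "\<lambda>n. case_prod C (prod_decode n)"])
      show "0 \<le> w \<tau>" for \<tau>
        using \<phi>_r by (simp add: w_def)
      show "w \<tau> \<le> (\<Sum>i\<in>Ch \<tau>. w (i # \<tau>))" for \<tau>
      proof -
        have "w \<tau> = (1/2) ^ Suc (length \<tau>) * (2 * \<phi> (r \<tau>))"
          by (simp add: w_def)
        also have "\<dots> \<le> (1/2) ^ Suc (length \<tau>) * (\<Sum>i\<in>Ch \<tau>. \<phi> (r (i # \<tau>)))"
          by (intro mult_left_mono Ch(3)) auto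
        also have "\<dots> = (\<Sum>i\<in>Ch \<tau>. w (i # \<tau>))"
          by (simp add: w_def sum_distrib_left)
        finally show ?thesis .
      qed
      show "(\<lambda>j. w (history x j)) \<longlonglongrightarrow> 0" if "x \<in> branches Ch" for x
      proof (rule tendsto_sandwich[of "\<lambda>_. 0" _ _ "\<lambda>j. (1/2) ^ j * M"])
        show "(\<lambda>j. (1/2) ^ j * M) \<longlonglongrightarrow> 0"
          by (intro tendsto_mult_left_zero LIMSEQ_realpow_zero) auto
        have "w (history x j) \<le> (1/2) ^ j * M" for j
          using r_antimono_history[OF that, of 0 j] less_imp_le[OF r_pos]
          by (auto simp: w_def M_def intro!: mult_left_mono gauge_mono[OF \<phi>])
        then show "\<forall>\<^sub>F j in sequentially. w (history x j) \<le> (1/2) ^ j * M"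
          by (simp add: always_eventually)
        show "\<forall>\<^sub>F j in sequentially. 0 \<le> w (history x j)"
          using \<phi>_r by (simp add: w_def always_eventually)
      qed auto
      show "limit_set \<subseteq> (\<Union>n. case_prod C (prod_decode n))"
      proof
        fix p assume "p \<in> limit_set"
        with F(1) C(1) obtain m n where "p \<in> C m n" by blast
        then show "p \<in> (\<Union>n. case_prod C (prod_decode n))"
          by (intro UN_I[of "prod_encode (m, n)"]) auto
      qed
      show "bounded (case_prod C (prod_decode n))" for n
        by (simp add: C(2) split: prod.split)
      show "ennreal (w \<tau>) \<le> b (prod_decode k)"
        if \<tau>: "node Ch \<tau>" "r \<tau> \<le> diameter (case_prod C (prod_decode k))" for k \<tau>
      proof -
        obtain m n where mn: "prod_decode k = (m, n)" by fastforce
        then have le: "r \<tau> \<le> diameter (C m n)"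
          using \<tau>(2) by simp
        have "w \<tau> \<le> (1/2) ^ L m * \<phi> (diameter (C m n))"
          unfolding w_def using C(3)[OF \<tau>(1) le] le less_imp_le[OF r_pos] \<phi>_r
          by (intro mult_mono power_decreasing gauge_mono[OF \<phi>]) auto
        then show ?thesis
          by (simp add: b_def mn ennreal_leI flip: ennreal_mult')
      qed
    qed
    also have "\<dots> = (\<Sum>m. ennreal ((1/2) ^ L m) * (\<Sum>n. ennreal (\<phi> (diameter (C m n)))))"
      by (rule suminf_ennreal_2dimen) (simp add: b_def)
    also have "\<dots> \<le> (\<Sum>m. ennreal ((1/2) ^ Suc m * (M / 2)))"
      using C(4) by (intro suminf_le) auto
    also have "\<dots> = ennreal (M / 2)"
      using sums_mult2[OF power_half_series, of "M / 2"] M by (intro suminf_ennreal_eq) auto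
    finally show False
      using M by (simp add: w_def M_def[symmetric] ennreal_le_iff)
  qed
  ultimately show thesis by (rule that)
qed

section \<open>Comparison of the ideals\<close>

theorem corollary4p3:
  fixes \<phi> :: "real \<Rightarrow> real" and s :: "nat \<Rightarrow> real"
  assumes "hausdorff_gauge \<phi>" and "s \<in> decr_null_seqs"
  shows "(dominated_sets (mult_subseqs s) :: ell2 set set) \<noteq> hausdorff_null \<phi> \<and>
         (dominated_sets (mult_subseqs s) :: ell2 set set) \<noteq> hausdorff_sigma_finite \<phi>"
proof (cases "summable (\<lambda>n. \<phi> (s (Suc n)))")
  case True
  then obtain E :: "ell2 set" where "E \<in> hausdorff_null \<phi>" "E \<notin> dominated_sets (mult_subseqs s)"
    using null_set_not_dominated[OF assms] by blast
  then show ?thesis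
    using hausdorff_null_subset_sigma_finite[of \<phi>] by blast
next
  case False
  then obtain E :: "ell2 set" where "E \<in> dominated_sets (mult_subseqs s)" "E \<notin> hausdorff_sigma_finite \<phi>"
    using dominated_set_not_sigma_finite[OF assms] by blast
  then show ?thesis
    using hausdorff_null_subset_sigma_finite[of \<phi>] by blast
qed

end
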